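(* There exist an instance of the integer bilevel nonlinear program, a second-order conic convex set $\mathcal P$ contained in the feasible set of $\overline{\mathrm{HPR}}$, a bilevel-infeasible point $(x^*,y^* )\in\mathcal P$ with $\Omega(x^* )\ne\emptyset$ and $F(x^* )\setminus\Omega(x^* )\neq\emptyset$, an optimal follower solution $\hat y_1\in\Omega(x^* )$ and a feasible but non-optimal follower solution $\hat y_2\in F(x^* )\setminus\Omega(x^* )$, such that two disjunctive cuts, one derived from $\mathcal D(\hat y_1,\mathcal P)$ and the other derived from $\mathcal D(\hat y_2,\mathcal P)$ (both separating $(x^*,y^* )$), do not dominate one another.
   Context: **Bilevel program.** Prime denotes transpose, $n=n_1+n_2$. The integer bilevel nonlinear program is $$\min\ c'x+d'y\quad\text{s.t. } Mx+Ny\ge h,\ \ \tilde Mx+\tilde Ny-\tilde h\in\mathcal K,\ \ y\in\Omega(x),\ \ x\in\mathbb Z^{n_1},$$ where $\Omega(x)$ is the set of optimal solutions of the follower problem $\min\{q(y): y\in F(x)\}$, $F(x)=\{y\in\mathbb Z^{n_2}: Ax+By\ge f,\ y\in\mathcal Y\}$. Here $A\in\mathbb Z^{m_2\times n_1}$, $B\in\mathbb Z^{m_2\times n_2}$, $f\in\mathbb Z^{m_2}$ with $i$-th rows/entries $A^i,B^i,f_i$ (each $A^i$ and $B^i$ has a nonzero entry); the other data are real; $\mathcal K$ is a cross-product of second-order cones (the leader constraints $Mx+Ny\ge h$ and $\tilde Mx+\tilde Ny-\tilde h\in\mathcal K$ may be absent); $\mathcal Y$ is a bounded polyhedron; $q(y)=y'Ry+g'y$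 with $R=V'V$, $V\in\mathbb R^{n_3\times n_2}$, $n_3\le n_2$. A point $(x,y)\in\mathbb R^n$ is bilevel feasible if it satisfies all constraints of the program, otherwise bilevel infeasible. **Relaxation.** $\overline{\mathrm{HPR}}$ is the problem of minimizing $c'x+d'y$ over the real points $(x,y)$ satisfying $Mx+Ny\ge h$, $\tilde Mx+\tilde Ny-\tilde h\in\mathcal K$, $Ax+By\ge f$, $y\in\mathcal Y$ and the (finite) variable bounds. It is assumed that all variables are bounded, that $\overline{\mathrm{HPR}}$ has a feasible solution satisfying the conic constraint strictly, and that its dual is feasible. **Disjunctions and cuts.** For $\hat y\in\mathcal Y\cap\mathbb Z^{n_2}$ let $\mathcal D_0(\hat y)$ be the condition $q(y)\le q(\hat y)$ and, for $i=1,\dots,m_2$, $\mathcal D_i(\hat y)$ the condition $A^ix\le f_i-B^i\hat y-1$. Put $$\mathcal D(\hat y,\mathcal P)=\operatorname{conv}\Big(\bigcup_{i=0}^{m_2}\{(x,y)\in\mathcal P:\mathcal D_i(\hat y)\text{ holds}\}\Big).$$ A disjunctive cut (DC) derived from $\mathcal D(\hat y,\mathcal P)$ for $(x^*,y^* )$ is a linear inequality $\alpha'x+\beta'y\ge\tau$ valid for all points of $\mathcal D(\hat y,\mathcal P)$ and violated by $(x^*,y^* )$. **Domination.** A DC $\alpha'x+\beta'y\ge\tau$ is dominating a DC $\bar\alpha'x+\bar\beta'y\ge\bar\tau$ if $\{(x,y)\in\mathcal P:\alpha'x+\beta'y\ge\tau\}\subseteq\{(x,y)\in\mathcal P:\bar\alpha'x+\bar\beta'y\ge\bar\tau\}$;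 otherwise it is not dominating it. *)

theory Defs
  imports Complex_Main "Jordan_Normal_Form.Matrix"
begin

section \<open>Second-order cones and convex hulls\<close>

text \<open>The order \<open>\<le>\<close> on vectors is componentwise and includes equality of the dimensions.\<close>

definition int_vecs :: "nat \<Rightarrow> real vec set" where
  "int_vecs n = {v \<in> carrier_vec n. \<forall>i<n. v $ i \<in> \<int>}"

text \<open>Entry 0 is the one that bounds the Euclidean norm of the others; the one-dimensional cone is
  the half-line of nonnegative numbers.\<close>

definition soc :: "nat \<Rightarrow> real vec set" where
  "soc k = {u \<in> carrier_vec k. sqrt (\<Sum>i = 1..<k. (u $ i)\<^sup>2) \<le> u $ 0}"

definition soc_interior :: "nat \<Rightarrow> real vec set" where
  "soc_interior k = {u \<in> carrier_vec k. sqrt (\<Sum>i = 1..<k. (u $ i)\<^sup>2) < u $ 0}"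

fun cross_prod :: "(nat \<Rightarrow> real vec set) \<Rightarrow> nat list \<Rightarrow> real vec set" where
  "cross_prod C [] = carrier_vec 0"
| "cross_prod C (k # ks) = {u @\<^sub>v v | u v. u \<in> C k \<and> v \<in> cross_prod C ks}"

text \<open>Points of the real space of dimension \<open>n1 + n2\<close> are pairs \<open>(x, y)\<close>. The set below is given by
  finitely many affine second-order cone constraints; linear inequalities are those whose cone has
  dimension 1.\<close>

type_synonym point = "real vec \<times> real vec"

definition soc_set :: "nat \<Rightarrow> nat \<Rightarrow> point set \<Rightarrow> bool" where
  "soc_set n1 n2 P \<longleftrightarrow>
     (\<exists>ks C E e. (\<forall>k \<in> set ks. 0 < k) \<and>
        C \<in> carrier_mat (sum_list ks) n1 \<and> E \<in> carrier_mat (sum_list ks) n2 \<and>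
        e \<in> carrier_vec (sum_list ks) \<and>
        P = {(x, y). x \<in> carrier_vec n1 \<and> y \<in> carrier_vec n2 \<and>
                     C *\<^sub>v x + E *\<^sub>v y - e \<in> cross_prod soc ks})"

text \<open>The set of all finite convex combinations. (The type \<open>real vec\<close> contains vectors of all
  dimensions and is not an instance of \<open>real_vector\<close>, so the library hull does not apply.)\<close>

definition conv_hull :: "nat \<Rightarrow> nat \<Rightarrow> point set \<Rightarrow> point set" where
  "conv_hull n1 n2 S = {(x, y). x \<in> carrier_vec n1 \<and> y \<in> carrier_vec n2 \<and>
     (\<exists>(k::nat) w p. (\<forall>j<k. 0 \<le> w j \<and> p j \<in> S) \<and> (\<Sum>j<k. w j) = 1 \<and>
        (\<forall>i<n1. x $ i = (\<Sum>j<k. w j * fst (p j) $ i)) \<and>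
        (\<forall>i<n2. y $ i = (\<Sum>j<k. w j * snd (p j) $ i)))}"

section \<open>Integer bilevel nonlinear programs\<close>

text \<open>\<open>mat_Mt\<close>, \<open>mat_Nt\<close>, \<open>vec_ht\<close> are the data with a tilde, the cone is the product of the
  second-order cones of dimensions \<open>cone_dims\<close>, and the follower polyhedron is
  \<open>{y. mat_G *\<^sub>v y \<ge> vec_e}\<close>. Leader constraints are absent if \<open>dim_m1 = 0\<close>, respectively
  \<open>cone_dims = []\<close>. The last four fields are the variable bounds.\<close>

record instance_data =
  dim_n1 :: nat
  dim_n2 :: nat
  dim_n3 :: nat
  dim_m1 :: nat
  dim_m2 :: nat
  dim_mY :: nat
  cone_dims :: "nat list"
  vec_c :: "real vec"
  vec_d :: "real vec"
  mat_M :: "real mat"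
  mat_N :: "real mat"
  vec_h :: "real vec"
  mat_Mt :: "real mat"
  mat_Nt :: "real mat"
  vec_ht :: "real vec"
  mat_A :: "real mat"
  mat_B :: "real mat"
  vec_f :: "real vec"
  mat_G :: "real mat"
  vec_e :: "real vec"
  mat_V :: "real mat"
  vec_g :: "real vec"
  low_x :: "real vec"
  upp_x :: "real vec"
  low_y :: "real vec"
  upp_y :: "real vec"

definition well_typed :: "instance_data \<Rightarrow> bool" where
  "well_typed I \<longleftrightarrow>
     0 < dim_n1 I \<and> 0 < dim_n2 I \<and> 0 < dim_m2 I \<and> 0 < dim_n3 I \<and> dim_n3 I \<le> dim_n2 I \<and>
     (\<forall>k \<in> set (cone_dims I). 0 < k) \<and>
     vec_c I \<in> carrier_vec (dim_n1 I) \<and> vec_d I \<in> carrier_vec (dim_n2 I) \<and>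
     mat_M I \<in> carrier_mat (dim_m1 I) (dim_n1 I) \<and>
     mat_N I \<in> carrier_mat (dim_m1 I) (dim_n2 I) \<and>
     vec_h I \<in> carrier_vec (dim_m1 I) \<and>
     mat_Mt I \<in> carrier_mat (sum_list (cone_dims I)) (dim_n1 I) \<and>
     mat_Nt I \<in> carrier_mat (sum_list (cone_dims I)) (dim_n2 I) \<and>
     vec_ht I \<in> carrier_vec (sum_list (cone_dims I)) \<and>
     mat_A I \<in> carrier_mat (dim_m2 I) (dim_n1 I) \<and>
     mat_B I \<in> carrier_mat (dim_m2 I) (dim_n2 I) \<and>
     vec_f I \<in> carrier_vec (dim_m2 I) \<and>
     mat_G I \<in> carrier_mat (dim_mY I) (dim_n2 I) \<and>
     vec_e I \<in> carrier_vec (dim_mY I) \<and>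
     mat_V I \<in> carrier_mat (dim_n3 I) (dim_n2 I) \<and>
     vec_g I \<in> carrier_vec (dim_n2 I) \<and>
     low_x I \<in> carrier_vec (dim_n1 I) \<and> upp_x I \<in> carrier_vec (dim_n1 I) \<and>
     low_y I \<in> carrier_vec (dim_n2 I) \<and> upp_y I \<in> carrier_vec (dim_n2 I)"

definition integral_follower :: "instance_data \<Rightarrow> bool" where
  "integral_follower I \<longleftrightarrow>
     (\<forall>i < dim_m2 I.
        (\<forall>j < dim_n1 I. mat_A I $$ (i, j) \<in> \<int>) \<and> (\<forall>j < dim_n2 I. mat_B I $$ (i, j) \<in> \<int>) \<and>
        vec_f I $ i \<in> \<int> \<and>
        (\<exists>j < dim_n1 I. mat_A I $$ (i, j) \<noteq> 0) \<and> (\<exists>j < dim_n2 I. mat_B I $$ (i, j) \<noteq> 0))"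

definition poly_Y :: "instance_data \<Rightarrow> real vec set" where
  "poly_Y I = {y \<in> carrier_vec (dim_n2 I). vec_e I \<le> mat_G I *\<^sub>v y}"

definition q :: "instance_data \<Rightarrow> real vec \<Rightarrow> real" where
  "q I y = y \<bullet> ((transpose_mat (mat_V I) * mat_V I) *\<^sub>v y) + vec_g I \<bullet> y"

definition follower_feasible :: "instance_data \<Rightarrow> real vec \<Rightarrow> real vec set" where
  "follower_feasible I x =
     {y \<in> int_vecs (dim_n2 I). vec_f I \<le> mat_A I *\<^sub>v x + mat_B I *\<^sub>v y \<and> y \<in> poly_Y I}"

definition follower_optimal :: "instance_data \<Rightarrow> real vec \<Rightarrow> real vec set" where
  "follower_optimal I x =
     {y \<in> follower_feasible I x. \<forall>z \<in> follower_feasible I x. q I y \<le> q I z}"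

definition leader_linear :: "instance_data \<Rightarrow> real vec \<Rightarrow> real vec \<Rightarrow> bool" where
  "leader_linear I x y \<longleftrightarrow> vec_h I \<le> mat_M I *\<^sub>v x + mat_N I *\<^sub>v y"

definition conic_slack :: "instance_data \<Rightarrow> real vec \<Rightarrow> real vec \<Rightarrow> real vec" where
  "conic_slack I x y = mat_Mt I *\<^sub>v x + mat_Nt I *\<^sub>v y - vec_ht I"

definition bilevel_feasible :: "instance_data \<Rightarrow> real vec \<Rightarrow> real vec \<Rightarrow> bool" where
  "bilevel_feasible I x y \<longleftrightarrow>
     leader_linear I x y \<and> conic_slack I x y \<in> cross_prod soc (cone_dims I) \<and>
     y \<in> follower_optimal I x \<and> x \<in> int_vecs (dim_n1 I)"

section \<open>The continuous relaxation\<close>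

definition relaxed_constraints :: "instance_data \<Rightarrow> real vec \<Rightarrow> real vec \<Rightarrow> bool" where
  "relaxed_constraints I x y \<longleftrightarrow>
     x \<in> carrier_vec (dim_n1 I) \<and> y \<in> carrier_vec (dim_n2 I) \<and>
     leader_linear I x y \<and> conic_slack I x y \<in> cross_prod soc (cone_dims I) \<and>
     vec_f I \<le> mat_A I *\<^sub>v x + mat_B I *\<^sub>v y \<and> y \<in> poly_Y I"

definition within_bounds :: "instance_data \<Rightarrow> real vec \<Rightarrow> real vec \<Rightarrow> bool" where
  "within_bounds I x y \<longleftrightarrow> low_x I \<le> x \<and> x \<le> upp_x I \<and> low_y I \<le> y \<and> y \<le> upp_y I"

definition HPR_feasible :: "instance_data \<Rightarrow> point set" where
  "HPR_feasible I = {(x, y). relaxed_constraints I x y \<and> within_bounds I x y}"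

text \<open>Feasibility of the conic dual of minimizing \<open>c'x + d'y\<close> over \<open>HPR_feasible\<close>. The multipliers
  belong, in this order, to the leader's linear constraints, the conic constraint (second-order
  cones are self-dual), the follower's linear constraints, the polyhedron, and the lower and upper
  bounds on \<open>x\<close> and on \<open>y\<close>.\<close>

definition HPR_dual_feasible :: "instance_data \<Rightarrow> bool" where
  "HPR_dual_feasible I \<longleftrightarrow>
     (\<exists>\<kappa> \<mu> \<nu> \<pi> \<sigma>x \<theta>x \<sigma>y \<theta>y.
        0\<^sub>v (dim_m1 I) \<le> \<kappa> \<and> \<mu> \<in> cross_prod soc (cone_dims I) \<and>
        0\<^sub>v (dim_m2 I) \<le> \<nu> \<and> 0\<^sub>v (dim_mY I) \<le> \<pi> \<and>
        0\<^sub>v (dim_n1 I) \<le> \<sigma>x \<and> 0\<^sub>v (dim_n1 I) \<le> \<theta>x \<and>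
        0\<^sub>v (dim_n2 I) \<le> \<sigma>y \<and> 0\<^sub>v (dim_n2 I) \<le> \<theta>y \<and>
        transpose_mat (mat_M I) *\<^sub>v \<kappa> + transpose_mat (mat_Mt I) *\<^sub>v \<mu>
          + transpose_mat (mat_A I) *\<^sub>v \<nu> + \<sigma>x - \<theta>x = vec_c I \<and>
        transpose_mat (mat_N I) *\<^sub>v \<kappa> + transpose_mat (mat_Nt I) *\<^sub>v \<mu>
          + transpose_mat (mat_B I) *\<^sub>v \<nu> + transpose_mat (mat_G I) *\<^sub>v \<pi> + \<sigma>y - \<theta>y = vec_d I)"

text \<open>The variable bounds are valid for, hence not an addition to, the constraints of the program.\<close>

definition bilevel_instance :: "instance_data \<Rightarrow> bool" where
  "bilevel_instance I \<longleftrightarrow>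
     well_typed I \<and> integral_follower I \<and>
     (\<exists>b. \<forall>y \<in> poly_Y I. \<forall>i < dim_n2 I. \<bar>y $ i\<bar> \<le> b) \<and>
     (\<forall>x y. relaxed_constraints I x y \<longrightarrow> within_bounds I x y) \<and>
     (\<exists>(x, y) \<in> HPR_feasible I. conic_slack I x y \<in> cross_prod soc_interior (cone_dims I)) \<and>
     HPR_dual_feasible I"

section \<open>Disjunctions, disjunctive cuts and domination\<close>

text \<open>Rows are numbered from 0 in the library, so disjunct \<open>Suc i\<close> uses row \<open>i\<close>.\<close>

fun disjunct :: "instance_data \<Rightarrow> real vec \<Rightarrow> nat \<Rightarrow> real vec \<Rightarrow> real vec \<Rightarrow> bool" where
  "disjunct I yh 0 x y \<longleftrightarrow> q I y \<le> q I yh"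
| "disjunct I yh (Suc i) x y \<longleftrightarrow>
     row (mat_A I) i \<bullet> x \<le> vec_f I $ i - row (mat_B I) i \<bullet> yh - 1"

definition disj_hull :: "instance_data \<Rightarrow> real vec \<Rightarrow> point set \<Rightarrow> point set" where
  "disj_hull I yh P = conv_hull (dim_n1 I) (dim_n2 I)
     (\<Union>i \<in> {0..dim_m2 I}. {(x, y) \<in> P. disjunct I yh i x y})"

text \<open>A triple \<open>(\<alpha>, \<beta>, \<tau>)\<close> stands for the inequality \<open>\<alpha>'x + \<beta>'y \<ge> \<tau>\<close>.\<close>

type_synonym cut = "real vec \<times> real vec \<times> real"

fun satisfies_cut :: "cut \<Rightarrow> point \<Rightarrow> bool" where
  "satisfies_cut (\<alpha>, \<beta>, \<tau>) (x, y) \<longleftrightarrow> \<alpha> \<bullet> x + \<beta> \<bullet> y \<ge> \<tau>"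

definition disjunctive_cut ::
  "instance_data \<Rightarrow> real vec \<Rightarrow> point set \<Rightarrow> point \<Rightarrow> cut \<Rightarrow> bool" where
  "disjunctive_cut I yh P z ct \<longleftrightarrow>
     yh \<in> poly_Y I \<inter> int_vecs (dim_n2 I) \<and>
     fst ct \<in> carrier_vec (dim_n1 I) \<and> fst (snd ct) \<in> carrier_vec (dim_n2 I) \<and>
     (\<forall>p \<in> disj_hull I yh P. satisfies_cut ct p) \<and> \<not> satisfies_cut ct z"

definition dominates :: "point set \<Rightarrow> cut \<Rightarrow> cut \<Rightarrow> bool" where
  "dominates P ct ct' \<longleftrightarrow> {p \<in> P. satisfies_cut ct p} \<subseteq> {p \<in> P. satisfies_cut ct' p}"

end

theory Submission
  imports Defs
begin

text \<open>With one leader and one follower variable, let the follower minimize \<open>y\<^sup>2\<close> over the integers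
  \<open>0 \<le> y \<le> 3\<close> with \<open>x + y \<ge> 1\<close>, and let the leader require \<open>\<bar>x\<bar> \<le> 2\<close>; \<open>\<P>\<close> is the whole
  relaxation, the quadrilateral with vertices \<open>(1,0)\<close>, \<open>(2,0)\<close>, \<open>(2,3)\<close>, \<open>(-2,3)\<close>. At
  \<open>(x\<^sup>*, y\<^sup>*) = (1,2)\<close> the follower solution \<open>0\<close> is optimal and gives the disjunction
  \<open>y \<le> 0 \<or> x \<le> 0\<close>, with facet \<open>3x + 2y \<le> 6\<close> through \<open>(2,0)\<close> and \<open>(0,3)\<close>; the solution \<open>1\<close> is
  not optimal and gives \<open>y \<le> 1 \<or> x \<le> -1\<close>, with facet \<open>2x + 3y \<le> 7\<close> through \<open>(2,1)\<close> and
  \<open>(-1,3)\<close>. Both facets cut off \<open>(1,2)\<close>; the first one keeps \<open>(0,3)\<close> and cuts off \<open>(2,1)\<close>, the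
  second one does the opposite.\<close>

section \<open>Valid inequalities on convex hulls\<close>

text \<open>Linear functionals commute with finite convex combinations, so the value at
  \<open>p\<close> is a weighted average of values that are at least \<open>\<tau>\<close>. Scalar
  products sum over the dimension of their second factor, hence the carrier conditions on
  \<open>S\<close>.\<close>

lemma satisfies_cut_conv_hull:
  assumes S: "\<And>x y. (x, y) \<in> S \<Longrightarrow>
      x \<in> carrier_vec n1 \<and> y \<in> carrier_vec n2 \<and> satisfies_cut (\<alpha>, \<beta>, \<tau>) (x, y)"
    and p: "p \<in> conv_hull n1 n2 S"
  shows "satisfies_cut (\<alpha>, \<beta>, \<tau>) p"
proof -
  obtain x y k w P where pxy: "p = (x, y)"
    and x: "x \<in> carrier_vec n1" and y: "y \<in> carrier_vec n2"
    and w: "\<And>j. j < (k::nat) \<Longrightarrow> 0 \<le> w j \<and> P j \<in> S" and w1: "(\<Sum>j<k. w j) = 1"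
    and xi: "\<And>i. i < n1 \<Longrightarrow> x $ i = (\<Sum>j<k. w j * fst (P j) $ i)"
    and yi: "\<And>i. i < n2 \<Longrightarrow> y $ i = (\<Sum>j<k. w j * snd (P j) $ i)"
    using p unfolding conv_hull_def by blast
  have Pj: "fst (P j) \<in> carrier_vec n1" "snd (P j) \<in> carrier_vec n2"
    "\<tau> \<le> \<alpha> \<bullet> fst (P j) + \<beta> \<bullet> snd (P j)" if "j < k" for j
    using w[OF that] S[of "fst (P j)" "snd (P j)"] by (cases "P j"; simp)+
  \<comment> \<open>Stated for general \<open>n\<close> and \<open>u\<close>, to serve both the
    \<open>x\<close> block and the \<open>y\<close> block.\<close>
  have lin: "a \<bullet> v = (\<Sum>j<k. w j * (a \<bullet> u j))"
    if v: "v \<in> carrier_vec n" and vi: "\<And>i. i < n \<Longrightarrow> v $ i = (\<Sum>j<k. w j * u j $ i)"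
      and u: "\<And>j. j < k \<Longrightarrow> u j \<in> carrier_vec n" for a v :: "real vec" and n u
  proof -
    have "a \<bullet> v = (\<Sum>i<n. \<Sum>j<k. w j * (a $ i * u j $ i))"
      using v vi by (simp add: scalar_prod_def sum_distrib_left atLeast0LessThan mult.left_commute)
    also have "\<dots> = (\<Sum>j<k. \<Sum>i<n. w j * (a $ i * u j $ i))"
      by (rule sum.swap)
    also have "\<dots> = (\<Sum>j<k. w j * (a \<bullet> u j))"
    proof (rule sum.cong[OF refl])
      fix j assume "j \<in> {..<k}"
      then have "dim_vec (u j) = n"
        using u by auto
      then show "(\<Sum>i<n. w j * (a $ i * u j $ i)) = w j * (a \<bullet> u j)"
        by (simp add: scalar_prod_def sum_distrib_left atLeast0LessThan)
    qed
    finally show ?thesis .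
  qed
  have "\<tau> = (\<Sum>j<k. w j * \<tau>)"
    by (simp add: w1 flip: sum_distrib_right)
  also have "\<dots> \<le> (\<Sum>j<k. w j * (\<alpha> \<bullet> fst (P j) + \<beta> \<bullet> snd (P j)))"
    using w Pj by (intro sum_mono mult_left_mono) auto
  also have "\<dots> = \<alpha> \<bullet> x + \<beta> \<bullet> y"
    using lin[OF x xi Pj(1)] lin[OF y yi Pj(2)] by (simp add: sum.distrib distrib_left)
  finally show ?thesis
    by (simp add: pxy)
qed

section \<open>Membership in products of cones\<close>

lemma cross_prod_carrier:
  assumes "\<And>k. C k \<subseteq> carrier_vec k"
  shows "cross_prod C ks \<subseteq> carrier_vec (sum_list ks)"
proof (induction ks)
  case (Cons k ks)
  then show ?case
    using assms[of k] by auto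
qed simp

text \<open>The factors have fixed dimensions, so the place of the split is determined. This
  replaces the existential decomposition by conditions on entries, which can be computed for
  concrete vectors.\<close>

lemma cross_prod_Cons_iff:
  assumes "\<And>k. C k \<subseteq> carrier_vec k"
  shows "v \<in> cross_prod C (k # ks) \<longleftrightarrow>
    v \<in> carrier_vec (k + sum_list ks) \<and> vec_first v k \<in> C k \<and>
    vec_last v (sum_list ks) \<in> cross_prod C ks"
proof
  assume "v \<in> cross_prod C (k # ks)"
  then obtain u t where v: "v = u @\<^sub>v t" and ut: "u \<in> C k" "t \<in> cross_prod C ks"
    by auto
  then have dims: "u \<in> carrier_vec k" "t \<in> carrier_vec (sum_list ks)"
    using assms cross_prod_carrier[of C ks, OF assms] by auto
  then have "vec_first v k = u" "vec_last v (sum_list ks) = t"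
    by (auto simp: v vec_first_def vec_last_def)
  with dims ut show "v \<in> carrier_vec (k + sum_list ks) \<and> vec_first v k \<in> C k \<and>
      vec_last v (sum_list ks) \<in> cross_prod C ks"
    by (simp add: v)
next
  assume "v \<in> carrier_vec (k + sum_list ks) \<and> vec_first v k \<in> C k \<and>
    vec_last v (sum_list ks) \<in> cross_prod C ks"
  then show "v \<in> cross_prod C (k # ks)"
    unfolding cross_prod.simps by (smt (verit) mem_Collect_eq vec_first_last_append)
qed

lemma soc_carrier: "soc k \<subseteq> carrier_vec k"
  and soc_interior_carrier: "soc_interior k \<subseteq> carrier_vec k"
  by (auto simp: soc_def soc_interior_def)

lemma soc_1_iff: "u \<in> soc (Suc 0) \<longleftrightarrow> u \<in> carrier_vec 1 \<and> 0 \<le> u $ 0"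
  by (simp add: soc_def)

lemma soc_2_iff: "u \<in> soc 2 \<longleftrightarrow> u \<in> carrier_vec 2 \<and> \<bar>u $ 1\<bar> \<le> u $ 0"
  by (simp add: soc_def numeral_2_eq_2)

lemma soc_interior_2_iff:
  "u \<in> soc_interior 2 \<longleftrightarrow> u \<in> carrier_vec 2 \<and> \<bar>u $ 1\<bar> < u $ 0"
  by (simp add: soc_interior_def numeral_2_eq_2)

lemmas cross_prod_soc_Cons_iff = cross_prod_Cons_iff[of soc, OF soc_carrier]
  cross_prod_Cons_iff[of soc_interior, OF soc_interior_carrier]

(* carrier_vecD and carrier_dim_vec loop when both are simp rules. *)
declare cross_prod.simps(2) [simp del] carrier_vecD [simp del] carrier_dim_vec [simp]

section \<open>Data with a single column\<close>

text \<open>As \<open>x\<close> and \<open>y\<close> have one coordinate each, every matrix of the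
  example is a column; the empty list encodes absent constraints.\<close>

definition column_mat :: "real list \<Rightarrow> real mat" where
  "column_mat as = mat (length as) 1 (\<lambda>(i, j). as ! i)"

definition column_vec :: "real list \<Rightarrow> real vec" where
  "column_vec as = vec (length as) (\<lambda>i. as ! i)"

lemma column_mat_dims [simp]:
  "dim_row (column_mat as) = length as" "dim_col (column_mat as) = 1"
  by (simp_all add: column_mat_def)

lemma column_mat_index [simp]: "i < length as \<Longrightarrow> column_mat as $$ (i, 0) = as ! i"
  by (simp add: column_mat_def)

lemma column_vec_dim [simp]: "dim_vec (column_vec as) = length as"
  by (simp add: column_vec_def)

lemma column_vec_index [simp]: "i < length as \<Longrightarrow> column_vec as $ i = as ! i"
  by (simp add: column_vec_def)

lemma row_column_mat_scalar_prod [simp]: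
  "\<lbrakk>i < length as; dim_vec x = Suc 0\<rbrakk> \<Longrightarrow> row (column_mat as) i \<bullet> x = as ! i * x $ 0"
  by (simp add: scalar_prod_def)

lemma less_eq_vec_1: "dim_vec u = Suc 0 \<Longrightarrow> u \<le> v \<longleftrightarrow> dim_vec v = Suc 0 \<and> u $ 0 \<le> v $ 0"
  by (auto simp: less_eq_vec_def)

lemma less_eq_vec_2:
  "dim_vec u = 2 \<Longrightarrow> u \<le> v \<longleftrightarrow> dim_vec v = 2 \<and> u $ 0 \<le> v $ 0 \<and> u $ 1 \<le> v $ 1"
  by (auto simp: less_eq_vec_def less_2_cases_iff)

lemma vec_eq_1: "dim_vec u = Suc 0 \<Longrightarrow> u = v \<longleftrightarrow> dim_vec v = Suc 0 \<and> u $ 0 = v $ 0"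
  by (auto intro!: eq_vecI)

section \<open>The instance and its relaxation\<close>

definition example :: instance_data where
  "example = \<lparr>
     dim_n1 = 1, dim_n2 = 1, dim_n3 = 1, dim_m1 = 0, dim_m2 = 1, dim_mY = 2, cone_dims = [2],
     vec_c = column_vec [1], vec_d = column_vec [1],
     mat_M = column_mat [], mat_N = column_mat [], vec_h = column_vec [],
     mat_Mt = column_mat [0, 1], mat_Nt = column_mat [0, 0], vec_ht = column_vec [-2, 0],
     mat_A = column_mat [1], mat_B = column_mat [1], vec_f = column_vec [1],
     mat_G = column_mat [1, -1], vec_e = column_vec [0, -3],
     mat_V = column_mat [1], vec_g = column_vec [0],
     low_x = column_vec [-2], upp_x = column_vec [2],
     low_y = column_vec [0], upp_y = column_vec [3]\<rparr>"

lemma example_sel [simp]: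
  "dim_n1 example = Suc 0" "dim_n2 example = Suc 0" "dim_n3 example = Suc 0"
  "dim_m1 example = 0" "dim_m2 example = Suc 0" "dim_mY example = 2" "cone_dims example = [2]"
  "vec_c example = column_vec [1]" "vec_d example = column_vec [1]"
  "mat_M example = column_mat []" "mat_N example = column_mat []"
  "vec_h example = column_vec []" "mat_Mt example = column_mat [0, 1]"
  "mat_Nt example = column_mat [0, 0]" "vec_ht example = column_vec [-2, 0]"
  "mat_A example = column_mat [1]" "mat_B example = column_mat [1]"
  "vec_f example = column_vec [1]" "mat_G example = column_mat [1, -1]"
  "vec_e example = column_vec [0, -3]" "mat_V example = column_mat [1]"
  "vec_g example = column_vec [0]" "low_x example = column_vec [-2]"
  "upp_x example = column_vec [2]" "low_y example = column_vec [0]"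
  "upp_y example = column_vec [3]"
  by (simp_all add: example_def)

lemma well_typed_example: "well_typed example"
  by (simp add: well_typed_def carrier_matI)

lemma integral_follower_example: "integral_follower example"
  by (simp add: integral_follower_def)

lemma poly_Y_example: "poly_Y example = {y \<in> carrier_vec 1. 0 \<le> y $ 0 \<and> y $ 0 \<le> 3}"
  by (auto simp: poly_Y_def less_eq_vec_2)

lemma q_example: "dim_vec y = Suc 0 \<Longrightarrow> q example y = (y $ 0)\<^sup>2"
  by (simp add: q_def scalar_prod_def power2_eq_square)

text \<open>The slack vector is \<open>(2, x)\<close>, which encodes the bound on \<bar>x\<bar> as a
  genuine second-order cone constraint.\<close>

lemma conic_slack_example:
  assumes "dim_vec x = Suc 0" "dim_vec y = Suc 0"
  shows "conic_slack example x y \<in> cross_prod soc [2] \<longleftrightarrow> \<bar>x $ 0\<bar> \<le> 2"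
    "conic_slack example x y \<in> cross_prod soc_interior [2] \<longleftrightarrow> \<bar>x $ 0\<bar> < 2"
  using assms
  by (simp_all add: conic_slack_def cross_prod_soc_Cons_iff soc_2_iff soc_interior_2_iff
      vec_first_def vec_last_def)

lemma relaxed_constraints_example:
  "relaxed_constraints example x y \<longleftrightarrow>
    x \<in> carrier_vec 1 \<and> y \<in> carrier_vec 1 \<and>
    \<bar>x $ 0\<bar> \<le> 2 \<and> 1 \<le> x $ 0 + y $ 0 \<and> 0 \<le> y $ 0 \<and> y $ 0 \<le> 3"
proof (cases "x \<in> carrier_vec 1 \<and> y \<in> carrier_vec 1")
  case True
  then show ?thesis
    by (auto simp: relaxed_constraints_def conic_slack_example poly_Y_example leader_linear_def)
      (simp_all add: less_eq_vec_1 less_eq_vec_def)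
next
  case False
  then show ?thesis
    by (auto simp: relaxed_constraints_def)
qed

lemma within_bounds_example:
  "relaxed_constraints example x y \<Longrightarrow> within_bounds example x y"
  unfolding relaxed_constraints_example
  by (auto simp: within_bounds_def less_eq_vec_1)

lemma HPR_feasible_example:
  "HPR_feasible example = {(x, y). x \<in> carrier_vec 1 \<and> y \<in> carrier_vec 1 \<and>
    \<bar>x $ 0\<bar> \<le> 2 \<and> 1 \<le> x $ 0 + y $ 0 \<and> 0 \<le> y $ 0 \<and> y $ 0 \<le> 3}"
  using within_bounds_example by (auto simp: HPR_feasible_def relaxed_constraints_example)

lemma HPR_dual_feasible_example: "HPR_dual_feasible example"
proof -
  have "column_vec [0, 0] \<in> cross_prod soc [2]"
    by (simp add: cross_prod_soc_Cons_iff soc_2_iff vec_first_def vec_last_def)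
  then show ?thesis
    unfolding HPR_dual_feasible_def
    \<comment> \<open>The objective x + y is the left-hand side of the follower row x + y \<ge> 1,
      so multiplier 1 on that row and 0 elsewhere suffices.\<close>
    by - (rule exI[of _ "column_vec []"], rule exI[of _ "column_vec [0, 0]"],
      rule exI[of _ "column_vec [1]"], rule exI[of _ "column_vec [0, 0]"],
      (rule exI[of _ "column_vec [0]"])+,
      simp add: less_eq_vec_def vec_eq_1 scalar_prod_def All_less_Suc2 numeral_2_eq_2)
qed

lemma bilevel_instance_example: "bilevel_instance example"
proof -
  have "\<forall>y \<in> poly_Y example. \<forall>i < dim_n2 example. \<bar>y $ i\<bar> \<le> 3"
    by (auto simp: poly_Y_example)
  moreover have "\<exists>(x, y) \<in> HPR_feasible example.
      conic_slack example x y \<in> cross_prod soc_interior (cone_dims example)"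
    by (rule bexI[of _ "(column_vec [1], column_vec [1])"])
      (simp_all add: conic_slack_example HPR_feasible_example)
  ultimately show ?thesis
    using well_typed_example integral_follower_example within_bounds_example
      HPR_dual_feasible_example
    unfolding bilevel_instance_def by blast
qed

lemma soc_set_HPR_example: "soc_set 1 1 (HPR_feasible example)"
proof -
  \<comment> \<open>The slack entries are 2, x, x + y - 1, y, 3 - y: one two-dimensional cone
    followed by three half-lines.\<close>
  let ?C = "column_mat [0, 1, 1, 0, 0]" and ?E = "column_mat [0, 0, 1, 1, -1]"
    and ?e = "column_vec [-2, 0, 1, 0, -3]"
  have "?C *\<^sub>v x + ?E *\<^sub>v y - ?e \<in> cross_prod soc [2, 1, 1, 1] \<longleftrightarrow>
      \<bar>x $ 0\<bar> \<le> 2 \<and> 1 \<le> x $ 0 + y $ 0 \<and> 0 \<le> y $ 0 \<and> y $ 0 \<le> 3"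
    if "x \<in> carrier_vec 1" "y \<in> carrier_vec 1" for x y
    using that
    by (auto simp: cross_prod_soc_Cons_iff soc_1_iff soc_2_iff[unfolded numeral_2_eq_2]
        vec_first_def vec_last_def numeral_eq_Suc)
  then have "HPR_feasible example = {(x, y). x \<in> carrier_vec 1 \<and> y \<in> carrier_vec 1 \<and>
      ?C *\<^sub>v x + ?E *\<^sub>v y - ?e \<in> cross_prod soc [2, 1, 1, 1]}"
    unfolding HPR_feasible_example by auto
  then show ?thesis
    unfolding soc_set_def
    by - (rule exI[of _ "[2, 1, 1, 1]"], rule exI[of _ ?C], rule exI[of _ ?E], rule exI[of _ ?e],
      simp add: carrier_matI)
qed

section \<open>The follower's problem at x = 1\<close>

text \<open>At x = 1 the row x + y \<ge> 1 reduces to y \<ge> 0, which the polyhedron already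
  imposes.\<close>

lemma follower_feasible_example:
  "follower_feasible example (column_vec [1]) =
    {y \<in> carrier_vec 1. y $ 0 \<in> \<int> \<and> 0 \<le> y $ 0 \<and> y $ 0 \<le> 3}"
  by (auto simp: follower_feasible_def poly_Y_example int_vecs_def)
    (simp_all add: less_eq_vec_1)

lemma follower_optimal_example:
  "y \<in> follower_optimal example (column_vec [1]) \<longleftrightarrow> dim_vec y = 1 \<and> y $ 0 = 0"
proof
  assume y: "y \<in> follower_optimal example (column_vec [1])"
  moreover have "column_vec [0] \<in> follower_feasible example (column_vec [1])"
    by (simp add: follower_feasible_example)
  ultimately have "q example y \<le> q example (column_vec [0])"
    by (simp add: follower_optimal_def)
  then show "dim_vec y = 1 \<and> y $ 0 = 0"
    using y by (auto simp: follower_optimal_def follower_feasible_example q_example)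
next
  assume "dim_vec y = 1 \<and> y $ 0 = 0"
  then show "y \<in> follower_optimal example (column_vec [1])"
    by (auto simp: follower_optimal_def follower_feasible_example q_example)
qed

section \<open>The two cuts\<close>

text \<open>Reduces validity on the hull to an implication between real inequalities, checked on the
  two pieces of the disjunction.\<close>

lemma disjunctive_cut_exampleI:
  fixes yh a b t :: real
  assumes yh: "0 \<le> yh" "yh \<le> 3" "yh \<in> \<int>"
    and valid: "\<And>x y. \<lbrakk>\<bar>x\<bar> \<le> 2; 1 \<le> x + y; 0 \<le> y; y \<le> 3; y \<le> yh \<or> x \<le> - yh\<rbrakk>
      \<Longrightarrow> t \<le> a * x + b * y"
    and violated: "a * xs + b * ys < t"
  shows "disjunctive_cut example (column_vec [yh]) (HPR_feasible example)
    (column_vec [xs], column_vec [ys]) (column_vec [a], column_vec [b], t)"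
proof -
  have "satisfies_cut (column_vec [a], column_vec [b], t) p"
    if "p \<in> disj_hull example (column_vec [yh]) (HPR_feasible example)" for p
  proof (rule satisfies_cut_conv_hull[OF _ that[unfolded disj_hull_def]])
    fix x y
    assume "(x, y) \<in> (\<Union>i\<in>{0..dim_m2 example}.
      {(x, y) \<in> HPR_feasible example. disjunct example (column_vec [yh]) i x y})"
    then obtain i where i: "i \<le> 1" and P: "(x, y) \<in> HPR_feasible example"
      and disj: "disjunct example (column_vec [yh]) i x y"
      by auto
    have dims: "dim_vec x = Suc 0" "dim_vec y = Suc 0"
      using P by (auto simp: HPR_feasible_example)
    \<comment> \<open>Since \<open>y $ 0\<close> and \<open>yh\<close> are nonnegative, comparing
      squares compares the numbers; the other disjunct has right-hand side 1 - yh - 1.\<close>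
    have "y $ 0 \<le> yh \<or> x $ 0 \<le> - yh"
    proof (cases i)
      case 0
      then show ?thesis
        using disj dims yh by (auto simp: q_example power2_le_iff_abs_le)
    next
      case (Suc i')
      then show ?thesis
        using disj dims i by (simp add: scalar_prod_def)
    qed
    then have "t \<le> a * x $ 0 + b * y $ 0"
      using P by (intro valid) (auto simp: HPR_feasible_example)
    then show "x \<in> carrier_vec (dim_n1 example) \<and> y \<in> carrier_vec (dim_n2 example) \<and>
        satisfies_cut (column_vec [a], column_vec [b], t) (x, y)"
      using dims by (simp add: scalar_prod_def)
  qed
  then show ?thesis
    using yh violated
    by (simp add: disjunctive_cut_def poly_Y_example int_vecs_def scalar_prod_def)
qed

theorem theorem2:
  shows "\<exists>I P xs ys yh1 yh2 ct1 ct2.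
    bilevel_instance I \<and>
    soc_set (dim_n1 I) (dim_n2 I) P \<and> P \<subseteq> HPR_feasible I \<and>
    (xs, ys) \<in> P \<and> \<not> bilevel_feasible I xs ys \<and>
    follower_optimal I xs \<noteq> {} \<and>
    follower_feasible I xs - follower_optimal I xs \<noteq> {} \<and>
    yh1 \<in> follower_optimal I xs \<and>
    yh2 \<in> follower_feasible I xs - follower_optimal I xs \<and>
    disjunctive_cut I yh1 P (xs, ys) ct1 \<and>
    disjunctive_cut I yh2 P (xs, ys) ct2 \<and>
    \<not> dominates P ct1 ct2 \<and> \<not> dominates P ct2 ct1"
proof -
  let ?P = "HPR_feasible example" and ?x = "column_vec [1]" and ?y = "column_vec [2]"
  \<comment> \<open>The facets 3x + 2y \<le> 6 and 2x + 3y \<le> 7, negated to fit the \<ge> form of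
    cuts.\<close>
  let ?ct1 = "(column_vec [-3], column_vec [-2], -6)"
    and ?ct2 = "(column_vec [-2], column_vec [-3], -7)"
  have P: "soc_set (dim_n1 example) (dim_n2 example) ?P"
    using soc_set_HPR_example by simp
  \<comment> \<open>Infeasibility comes from y = 2 not being optimal for the follower.\<close>
  have z: "(?x, ?y) \<in> ?P" "\<not> bilevel_feasible example ?x ?y"
    by (auto simp: HPR_feasible_example bilevel_feasible_def follower_optimal_example)
  have y1: "column_vec [0] \<in> follower_optimal example ?x"
    by (simp add: follower_optimal_example)
  have y2: "column_vec [1] \<in> follower_feasible example ?x - follower_optimal example ?x"
    by (simp add: follower_optimal_example follower_feasible_example)
  have ct1: "disjunctive_cut example (column_vec [0]) ?P (?x, ?y) ?ct1"
    by (rule disjunctive_cut_exampleI) auto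
  have ct2: "disjunctive_cut example (column_vec [1]) ?P (?x, ?y) ?ct2"
    by (rule disjunctive_cut_exampleI) auto
  \<comment> \<open>Each point lies on one facet and beyond the other: at (0,3), 2x + 3y = 9 > 7; at
    (2,1), 3x + 2y = 8 > 6.\<close>
  have "(column_vec [0], column_vec [3]) \<in> ?P" "(column_vec [2], column_vec [1]) \<in> ?P"
    by (simp_all add: HPR_feasible_example)
  moreover have "satisfies_cut ?ct1 (column_vec [0], column_vec [3])"
    "\<not> satisfies_cut ?ct2 (column_vec [0], column_vec [3])"
    "satisfies_cut ?ct2 (column_vec [2], column_vec [1])"
    "\<not> satisfies_cut ?ct1 (column_vec [2], column_vec [1])"
    by (simp_all add: scalar_prod_def)
  ultimately have "\<not> dominates ?P ?ct1 ?ct2" "\<not> dominates ?P ?ct2 ?ct1"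
    unfolding dominates_def by blast+
  with y1 y2 have "follower_optimal example ?x \<noteq> {} \<and>
      follower_feasible example ?x - follower_optimal example ?x \<noteq> {} \<and>
      \<not> dominates ?P ?ct1 ?ct2 \<and> \<not> dominates ?P ?ct2 ?ct1"
    by blast
  with bilevel_instance_example P z y1 y2 ct1 ct2 show ?thesis
    by blast
qed

end
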